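(* For any integer $r\ge1$ and any $k\ge 2$, any $r$-round algorithm in the coordinator model with $k$ sites that finds the optimal solution of a $2$-dimensional linear program with $n$ constraints partitioned across the $k$ sites with probability at least $2/3$ requires $\Omega\left(\frac{1}{r^2}\cdot n^{1/2r}\right)$ communication.
   Context: A $2$-dimensional linear program with $n$ constraints is $\min_{x\in\mathbb{R}^2} c_1x_1+c_2x_2$ subject to $n$ linear inequality constraints. Coordinator model: $k$ sites, each connected to a central coordinator by a two-way channel; the input constraints are partitioned among the sites; computation proceeds in rounds, in each of which the coordinator sends a message to each site and then each site replies to the coordinator; at the end the coordinator outputs the answer. Communication is the total number of bits exchanged. *)

theory Defs
  imports "HOL-Probability.Probability"
begin

section \<open>Linear programs in the plane\<close>

text \<open>The pair \<open>(a, b)\<close> is the inequality \<open>a \<bullet> x \<le> b\<close>.\<close>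

type_synonym lin_constr = "(real ^ 2) \<times> real"

definition feasible :: "lin_constr set \<Rightarrow> (real ^ 2) set" where
  "feasible S = {x. \<forall>(a, b) \<in> S. a \<bullet> x \<le> b}"

definition lp_optimal :: "real ^ 2 \<Rightarrow> lin_constr set \<Rightarrow> real ^ 2 \<Rightarrow> bool" where
  "lp_optimal c S x \<longleftrightarrow> is_arg_min (\<lambda>y. c \<bullet> y) (\<lambda>y. y \<in> feasible S) x"

text \<open>A linear program distributed over the sites \<open>0, \<dots>, k - 1\<close> is a pair \<open>(c, I)\<close>: \<open>c\<close> is the
  objective and \<open>I j\<close> lists the constraints held by site \<open>j\<close>. Values \<open>I j\<close> for \<open>j \<ge> k\<close> are
  never looked at.\<close>

type_synonym dist_lp = "(real ^ 2) \<times> (nat \<Rightarrow> lin_constr list)"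

definition all_constrs :: "nat \<Rightarrow> (nat \<Rightarrow> lin_constr list) \<Rightarrow> lin_constr set" where
  "all_constrs k I = (\<Union>j<k. set (I j))"

definition int_bounded :: "real \<Rightarrow> real \<Rightarrow> bool" where
  "int_bounded B u \<longleftrightarrow> u \<in> \<int> \<and> \<bar>u\<bar> \<le> B"

text \<open>The inputs with \<open>n\<close> constraints that have an optimal solution, are partitioned in an arbitrary
  way (parts may be empty), and whose coefficients are integers of absolute value at most \<open>B\<close>.

  Some bound on the precision is needed for a lower bound in terms of \<open>n\<close> to carry information:
  with coefficients of unbounded length, already the number of possible answers forces unbounded
  communication. An algorithm for a larger class of linear programs (such as all of them) is in
  particular an algorithm for this class.\<close>

definition lp_inputs :: "nat \<Rightarrow> nat \<Rightarrow> real \<Rightarrow> dist_lp set" where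
  "lp_inputs k n B = {(c, I).
     (\<Sum>j<k. length (I j)) = n \<and>
     (\<forall>i. int_bounded B (c $ i)) \<and>
     (\<forall>(a, b) \<in> all_constrs k I. (\<forall>i. int_bounded B (a $ i)) \<and> int_bounded B b) \<and>
     (\<exists>x. lp_optimal c (all_constrs k I) x)}"


section \<open>The coordinator model\<close>

type_synonym msg = "bool list"

text \<open>A deterministic protocol. The objective is known to all parties.

  \<^item> \<open>coord_msg P c H j\<close> is what the coordinator sends to site \<open>j\<close> when \<open>H\<close> contains, for each earlier
    round, the list of the replies of the sites \<open>0, \<dots>, k - 1\<close>.
  \<^item> \<open>site_msg P c j D R\<close> is the reply of site \<open>j\<close> holding the constraints \<open>D\<close> when \<open>R\<close> lists
    the messages it has received from the coordinator, the one of the current round included.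
  \<^item> \<open>answer P c H\<close> is the output of the coordinator after the last round.

  Messages may be empty, and messages need not be prefix-free.\<close>

record det_protocol =
  coord_msg :: "real ^ 2 \<Rightarrow> msg list list \<Rightarrow> nat \<Rightarrow> msg"
  site_msg :: "real ^ 2 \<Rightarrow> nat \<Rightarrow> lin_constr list \<Rightarrow> msg list \<Rightarrow> msg"
  answer :: "real ^ 2 \<Rightarrow> msg list list \<Rightarrow> real ^ 2"

definition received :: "det_protocol \<Rightarrow> real ^ 2 \<Rightarrow> msg list list \<Rightarrow> nat \<Rightarrow> msg list" where
  "received P c H j = map (\<lambda>s. coord_msg P c (take s H) j) [0..<Suc (length H)]"

text \<open>The replies of all sites in the first \<open>t\<close> rounds.\<close>

fun replies :: "det_protocol \<Rightarrow> nat \<Rightarrow> dist_lp \<Rightarrow> nat \<Rightarrow> msg list list" where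
  "replies P k (c, I) 0 = []"
| "replies P k (c, I) (Suc t) =
     (let H = replies P k (c, I) t
      in H @ [map (\<lambda>j. site_msg P c j (I j) (received P c H j)) [0..<k]])"

definition run_output :: "nat \<Rightarrow> nat \<Rightarrow> det_protocol \<Rightarrow> dist_lp \<Rightarrow> real ^ 2" where
  "run_output r k P X = answer P (fst X) (replies P k X r)"

text \<open>The bits sent in both directions over all channels during \<open>r\<close> rounds.\<close>

definition run_bits :: "nat \<Rightarrow> nat \<Rightarrow> det_protocol \<Rightarrow> dist_lp \<Rightarrow> nat" where
  "run_bits r k P X =
     (\<Sum>t<r. \<Sum>j<k. length (coord_msg P (fst X) (replies P k X t) j)
                + length (replies P k X r ! t ! j))"

text \<open>A randomized protocol is a probability distribution over deterministic protocols, that is, all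
  parties have access to common random bits; private random bits are a special case. If the
  event below were not measurable, then its \<open>measure\<close> would be \<open>0\<close>.\<close>

definition solves_lps :: "nat \<Rightarrow> nat \<Rightarrow> dist_lp set \<Rightarrow> det_protocol measure \<Rightarrow> bool" where
  "solves_lps r k \<X> M \<longleftrightarrow> prob_space M \<and>
     (\<forall>(c, I) \<in> \<X>.
        measure M {P \<in> space M. lp_optimal c (all_constrs k I) (run_output r k P (c, I))} \<ge> 2 / 3)"

definition comm_at_most :: "nat \<Rightarrow> nat \<Rightarrow> dist_lp set \<Rightarrow> det_protocol measure \<Rightarrow> nat \<Rightarrow> bool" where
  "comm_at_most r k \<X> M C \<longleftrightarrow> (\<forall>P \<in> space M. \<forall>X \<in> \<X>. run_bits r k P X \<le> C)"

end

theory Submission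
  imports Defs
begin

text \<open>Put the constraints at two sites. An algorithm with \<open>r\<close> rounds then becomes a two-party protocol
  with \<open>2 r\<close> alternating messages. It has to solve a nested indexing game: one party holds \<open>B\<close>
  independent instances of a shorter game, the other party knows which of them matters. A first message
  that is much shorter than \<open>B\<close> says almost nothing about the relevant instance, so it can be dropped at
  the cost of a small error. After \<open>2 r\<close> such steps a uniform bit has to be guessed without any
  communication, which forces \<open>C\<close> to be of order \<open>B / r\<^sup>2\<close>, where \<open>B\<close> is about \<open>n\<close> to the power \<open>1 / (2 r)\<close>.

  In the plane the game is the search for the leftmost point above a convex chain of lines of the one
  party and below a concave chain of the other. The \<open>B\<close> instances become consecutive blocks of the convex
  chain, and the bit is the parity of the abscissa of the optimum.\<close>

section \<open>Messages about many independent coordinates\<close>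

text \<open>On [0, 1] the exponential lies below its chord, which reduces the claim to a Bernoulli
  variable of the same mean \<open>p\<close>. Monotonicity in the mean, from
  \<open>\<theta> > 0\<close>, then replaces \<open>p\<close> by its bound \<open>v\<close>.\<close>

lemma sum_exp_le_Hoeffding:
  fixes g :: "'a \<Rightarrow> real"
  assumes "finite A" "A \<noteq> {}" "\<theta> > 0"
    and g: "\<And>z. z \<in> A \<Longrightarrow> 0 \<le> g z \<and> g z \<le> 1"
    and v: "(\<Sum>z\<in>A. g z) \<le> v * real (card A)"
  shows "(\<Sum>z\<in>A. exp (\<theta> * (g z - v))) \<le> real (card A) * exp (\<theta>\<^sup>2 / 8)"
proof -
  define N where "N = real (card A)"
  have "N > 0" using assms by (simp add: N_def card_gt_0_iff)
  define p where "p = (\<Sum>z\<in>A. g z) / N"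
  have p: "0 \<le> p" "p \<le> v"
    using v \<open>N > 0\<close> g by (auto simp: p_def N_def field_simps intro!: sum_nonneg)
  have exp_le: "exp (\<theta> * g z) \<le> 1 + g z * (exp \<theta> - 1)" if "z \<in> A" for z
  proof -
    have "exp (\<theta> * ((1 - g z) *\<^sub>R 0 + g z *\<^sub>R 1)) \<le> (1 - g z) * exp (\<theta> * 0) + g z * exp (\<theta> * 1)"
      using convex_onD[OF convex_on_exp[of \<theta>], of "g z" 0 1] g[OF that] \<open>\<theta> > 0\<close> by simp
    then show ?thesis by (simp add: algebra_simps)
  qed
  have "(\<Sum>z\<in>A. exp (\<theta> * g z)) \<le> (\<Sum>z\<in>A. 1 + g z * (exp \<theta> - 1))"
    by (intro sum_mono exp_le)
  also have "\<dots> = N * (1 + p * (exp \<theta> - 1))"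
    using \<open>N > 0\<close> by (simp add: sum.distrib N_def p_def distrib_left flip: sum_distrib_right)
  also have "\<dots> \<le> N * exp (\<theta> * p + \<theta>\<^sup>2 / 8)"
  proof -
    have pos: "1 + p * (exp \<theta> - 1) > 0"
      using p \<open>\<theta> > 0\<close> by (smt (verit) mult_nonneg_nonneg one_le_exp_iff)
    have "ln (1 + p * (exp \<theta> - 1)) \<le> \<theta> * p + \<theta>\<^sup>2 / 8"
      using Hoeffdings_lemma_aux[of \<theta> p] p \<open>\<theta> > 0\<close> by simp
    then have "1 + p * (exp \<theta> - 1) \<le> exp (\<theta> * p + \<theta>\<^sup>2 / 8)"
      using pos by (metis exp_le_cancel_iff exp_ln)
    then show ?thesis
      using \<open>N > 0\<close> by simp
  qed
  also have "\<dots> \<le> N * exp (\<theta> * v + \<theta>\<^sup>2 / 8)"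
    using p \<open>N > 0\<close> \<open>\<theta> > 0\<close> by simp
  finally have "(\<Sum>z\<in>A. exp (\<theta> * g z)) * exp (- (\<theta> * v)) \<le> N * exp (\<theta> * v + \<theta>\<^sup>2 / 8) * exp (- (\<theta> * v))"
    by (rule mult_right_mono) simp
  then show ?thesis
    by (simp add: N_def sum_distrib_right right_diff_distrib mult.assoc flip: exp_add)
qed

text \<open>The message \<open>m f\<close> may depend on all of \<open>f\<close>, yet it helps little on average over the
  coordinates: by Jensen the exponential of the average excess is at most the average exponential
  of the maximal excess over all messages, and the maximum is bounded by the sum.\<close>

lemma sum_message_gain_le:
  fixes g :: "'m \<Rightarrow> nat \<Rightarrow> 'a \<Rightarrow> real"
  assumes G: "finite G" "G \<noteq> {}" and M: "finite \<M>" and "B > 0" "\<theta> > 0"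
    and m: "\<And>f. f \<in> {..<B} \<rightarrow>\<^sub>E G \<Longrightarrow> m f \<in> \<M>"
    and g: "\<And>\<mu> i z. i < B \<Longrightarrow> z \<in> G \<Longrightarrow> 0 \<le> g \<mu> i z \<and> g \<mu> i z \<le> 1"
    and v: "\<And>\<mu> i. i < B \<Longrightarrow> (\<Sum>z\<in>G. g \<mu> i z) \<le> v * real (card G)"
  shows "(\<Sum>f\<in>{..<B} \<rightarrow>\<^sub>E G. \<Sum>i<B. g (m f) i (f i))
           \<le> real (card ({..<B} \<rightarrow>\<^sub>E G)) * real B * (v + (ln (card \<M>) / (\<theta> * B) + \<theta> / 8))"
proof -
  define \<F> where "\<F> = {..<B} \<rightarrow>\<^sub>E G"
  define N where "N = real (card \<F>)"
  define h where "h \<mu> f = (\<Sum>i<B. g \<mu> i (f i) - v)" for \<mu> f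
  have N_eq: "N = real (card G) ^ B"
    by (simp add: N_def \<F>_def card_PiE)
  have "N > 0" using G by (simp add: N_eq card_gt_0_iff)
  have fin: "finite \<F>"
    using G by (auto simp: \<F>_def intro!: finite_PiE)
  obtain f0 where "f0 \<in> \<F>" using \<open>N > 0\<close> by (auto simp: N_def card_gt_0_iff)
  then have "\<M> \<noteq> {}" using m by (auto simp: \<F>_def)
  then have K: "real (card \<M>) > 0" using M by (simp add: card_gt_0_iff)
  have mgf: "(\<Sum>f\<in>\<F>. exp (\<theta> * h \<mu> f)) \<le> N * exp (B * \<theta>\<^sup>2 / 8)" for \<mu>
  proof -
    have "(\<Sum>f\<in>\<F>. exp (\<theta> * h \<mu> f)) = (\<Sum>f\<in>\<F>. \<Prod>i<B. exp (\<theta> * (g \<mu> i (f i) - v)))"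
      by (simp add: h_def sum_distrib_left exp_sum)
    also have "\<dots> = (\<Prod>i<B. \<Sum>z\<in>G. exp (\<theta> * (g \<mu> i z - v)))"
      unfolding \<F>_def using G by (subst prod_sum_PiE) auto
    also have "\<dots> \<le> (\<Prod>i<B. real (card G) * exp (\<theta>\<^sup>2 / 8))"
      using G g v \<open>\<theta> > 0\<close> by (intro prod_mono) (auto intro!: sum_nonneg sum_exp_le_Hoeffding)
    also have "\<dots> = N * exp (B * \<theta>\<^sup>2 / 8)"
      by (simp add: N_eq power_mult_distrib flip: exp_of_nat_mult)
    finally show ?thesis .
  qed
  define a where "a = (\<Sum>f\<in>\<F>. h (m f) f) / N"
  \<comment> \<open>Jensen's inequality via the tangent of the exponential at
    \<open>\<theta> * a\<close>: since \<open>a\<close> is the mean, the linear terms cancel in the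
    sum.\<close>
  have "N * exp (\<theta> * a) = (\<Sum>f\<in>\<F>. exp (\<theta> * a) * (1 + \<theta> * (h (m f) f - a)))"
    using \<open>N > 0\<close>
    by (simp add: sum.distrib sum_subtractf right_diff_distrib distrib_left a_def N_def
        flip: sum_distrib_left)
  also have "\<dots> \<le> (\<Sum>f\<in>\<F>. exp (\<theta> * a) * exp (\<theta> * (h (m f) f - a)))"
    by (intro sum_mono mult_left_mono) (auto simp: exp_ge_add_one_self)
  also have "\<dots> = (\<Sum>f\<in>\<F>. exp (\<theta> * h (m f) f))"
    by (simp add: right_diff_distrib flip: exp_add)
  also have "\<dots> \<le> (\<Sum>f\<in>\<F>. \<Sum>\<mu>\<in>\<M>. exp (\<theta> * h \<mu> f))"
    using M m by (intro sum_mono member_le_sum) (auto simp: \<F>_def)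
  also have "\<dots> \<le> (\<Sum>\<mu>\<in>\<M>. N * exp (B * \<theta>\<^sup>2 / 8))"
    by (subst sum.swap) (intro sum_mono mgf)
  also have "\<dots> = N * exp (ln (card \<M>) + B * \<theta>\<^sup>2 / 8)"
    using K by (simp add: exp_add)
  finally have "\<theta> * a \<le> ln (card \<M>) + B * \<theta>\<^sup>2 / 8"
    using \<open>N > 0\<close> by simp
  then have "a \<le> (ln (card \<M>) + B * \<theta>\<^sup>2 / 8) / \<theta>"
    using \<open>\<theta> > 0\<close> by (simp add: pos_le_divide_eq mult.commute)
  also have "\<dots> = B * (ln (card \<M>) / (\<theta> * B) + \<theta> / 8)"
    using \<open>\<theta> > 0\<close> \<open>B > 0\<close> by (simp add: field_simps power2_eq_square)
  finally have "a \<le> B * (ln (card \<M>) / (\<theta> * B) + \<theta> / 8)" .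
  then have "N * (a + B * v) \<le> N * (B * (ln (card \<M>) / (\<theta> * B) + \<theta> / 8) + B * v)"
    using \<open>N > 0\<close> by (intro mult_left_mono add_right_mono) auto
  also have "\<dots> = N * B * (v + (ln (card \<M>) / (\<theta> * B) + \<theta> / 8))"
    by (simp only: distrib_left add.commute mult.assoc)
  finally have "N * (a + B * v) \<le> N * B * (v + (ln (card \<M>) / (\<theta> * B) + \<theta> / 8))" .
  moreover have "(\<Sum>f\<in>\<F>. \<Sum>i<B. g (m f) i (f i)) = N * (a + B * v)"
    using \<open>N > 0\<close> by (simp add: a_def h_def sum_subtractf N_def field_simps)
  ultimately show ?thesis
    unfolding N_def[symmetric] \<F>_def[symmetric] by simp
qed

section \<open>Round elimination\<close>

text \<open>In a game with \<open>R + 1\<close> messages the first party holds a table of \<open>B\<close> inputs of the second party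
  for the game with \<open>R\<close> messages; the second party holds a position in the table and an input of the
  first party for the shorter game, which is then played with exchanged roles.\<close>

datatype hinput = Blank | Bit bool | Table "nat \<Rightarrow> hinput" | Pointer nat hinput

fun first_inputs :: "nat \<Rightarrow> nat \<Rightarrow> hinput set"
  and second_inputs :: "nat \<Rightarrow> nat \<Rightarrow> hinput set" where
  "first_inputs B 0 = {Blank}"
| "first_inputs B (Suc R) = Table ` ({..<B} \<rightarrow>\<^sub>E second_inputs B R)"
| "second_inputs B 0 = {Bit False, Bit True}"
| "second_inputs B (Suc R) = case_prod Pointer ` ({..<B} \<times> first_inputs B R)"

fun hidden_bit :: "nat \<Rightarrow> hinput \<Rightarrow> hinput \<Rightarrow> bool" where
  "hidden_bit (Suc R) (Table f) (Pointer i y) = hidden_bit R y (f i)"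
| "hidden_bit R x y = (y = Bit True)"

text \<open>The arguments are swapped after each message: its receiver speaks next, and the receiver of the
  last message announces the result.\<close>

fun alternating :: "'m set \<Rightarrow> nat \<Rightarrow> ('x \<Rightarrow> 'x \<Rightarrow> 'a) \<Rightarrow> bool" where
  "alternating \<M> 0 w \<longleftrightarrow> (\<exists>h. w = (\<lambda>x y. h x))"
| "alternating \<M> (Suc R) w \<longleftrightarrow>
     (\<exists>m w'. (\<forall>x. m x \<in> \<M>) \<and> (\<forall>\<mu>. alternating \<M> R (w' \<mu>)) \<and> w = (\<lambda>x y. w' (m x) y x))"

text \<open>Local preprocessing costs no message. Round elimination uses this to play the shorter
  game inside the longer one.\<close>

lemma alternating_reduce:
  "alternating \<M> R w \<Longrightarrow> alternating \<M> R (\<lambda>x y. w (f x) (g y))"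
proof (induction R arbitrary: w f g)
  case (Suc R)
  then obtain m w' where m: "\<And>x. m x \<in> \<M>" and w': "\<And>\<mu>. alternating \<M> R (w' \<mu>)"
    and w: "w = (\<lambda>x y. w' (m x) y x)" by auto
  show ?case
    using m Suc.IH[OF w', of _ g f]
    by (auto intro!: exI[of _ "\<lambda>x. m (f x)"] exI[of _ "\<lambda>\<mu> x y. w' \<mu> (g x) (f y)"] simp: w)
qed auto

text \<open>A message with one possible value says nothing. Messages are removed in pairs, so that
  the same party is again the one to speak.\<close>

lemma alternating_single_message:
  "alternating {\<mu>} (2 * R) w \<Longrightarrow> alternating {\<mu>} 0 w"
proof (induction R arbitrary: w)
  case (Suc R)
  then obtain m\<^sub>1 w\<^sub>1 where "\<And>x. m\<^sub>1 x = \<mu>" "w = (\<lambda>x y. w\<^sub>1 (m\<^sub>1 x) y x)"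
    and "alternating {\<mu>} (Suc (2 * R)) (w\<^sub>1 \<mu>)"
    by auto
  moreover then obtain m\<^sub>2 w\<^sub>2 where "\<And>x. m\<^sub>2 x = \<mu>" "w\<^sub>1 \<mu> = (\<lambda>x y. w\<^sub>2 (m\<^sub>2 x) y x)"
    and "alternating {\<mu>} (2 * R) (w\<^sub>2 \<mu>)"
    by auto
  ultimately have "alternating {\<mu>} (2 * R) w"
    by simp
  then show ?case by (rule Suc.IH)
qed simp

lemma finite_inputs:
  "finite (first_inputs B R) \<and> finite (second_inputs B R)"
  by (induction R) (auto intro!: finite_PiE)

lemma inputs_nonempty:
  "B > 0 \<Longrightarrow> first_inputs B R \<noteq> {} \<and> second_inputs B R \<noteq> {}"
  by (induction R) (auto simp: PiE_eq_empty_iff)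

text \<open>Each message is worth at most one summand \<open>\<epsilon>\<close>. Once the first
  message is frozen, the rest is a protocol for the shorter game, bounded by induction; letting the
  message depend on the whole table gains little, as the pointer is independent of it. Without
  messages a uniform bit is guessed.\<close>

lemma alternating_success_le:
  fixes w :: "hinput \<Rightarrow> hinput \<Rightarrow> bool"
  assumes "finite \<M>" "B > 0" "\<theta> > 0" "alternating \<M> R w"
  shows "(\<Sum>x\<in>first_inputs B R. \<Sum>y\<in>second_inputs B R. of_bool (w x y = hidden_bit R x y))
    \<le> real (card (first_inputs B R)) * real (card (second_inputs B R))
        * (1 / 2 + R * (ln (card \<M>) / (\<theta> * B) + \<theta> / 8))"
  using assms(4)
proof (induction R arbitrary: w)
  case 0
  then obtain h where "w = (\<lambda>x y. h x)" by auto
  then show ?case by (cases "h Blank") auto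
next
  case (Suc R)
  define F where "F = first_inputs B R"
  define G where "G = second_inputs B R"
  define \<F> where "\<F> = {..<B} \<rightarrow>\<^sub>E G"
  define \<epsilon> where "\<epsilon> = ln (card \<M>) / (\<theta> * B) + \<theta> / 8"
  have FG: "finite F" "finite G" "F \<noteq> {}" "G \<noteq> {}"
    using finite_inputs inputs_nonempty \<open>B > 0\<close> by (auto simp: F_def G_def)
  then have cF: "real (card F) > 0" by (simp add: card_gt_0_iff)
  have "finite \<F>" using FG by (auto simp: \<F>_def intro!: finite_PiE)
  obtain m w' where m: "\<And>x. m x \<in> \<M>" and w': "\<And>\<mu>. alternating \<M> R (w' \<mu>)"
    and w: "w = (\<lambda>x y. w' (m x) y x)" using Suc.prems by auto
  \<comment> \<open>Success rate over \<open>y\<close> with the first message frozen to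
    \<open>\<mu>\<close> and the hidden entry taken to be \<open>z\<close>, even if
    \<open>f i\<close> differs from \<open>z\<close>.\<close>
  define s where "s \<mu> i f z = (\<Sum>y\<in>F. of_bool (w' \<mu> (Pointer i y) (Table f) = hidden_bit R y z)) / real (card F)"
    for \<mu> i f z
  text \<open>In the shorter game the second party, with input \<open>z\<close>, pretends to hold the table \<open>e \<mu> i z\<close> that
    is best for it. This table may depend on \<open>z\<close> arbitrarily and need not contain it.\<close>
  have "\<exists>e. \<forall>f\<in>\<F>. s \<mu> i f z \<le> s \<mu> i e z" for \<mu> i z
  proof (cases "\<F> = {}")
    case False
    then have "Max ((\<lambda>f. s \<mu> i f z) ` \<F>) \<in> (\<lambda>f. s \<mu> i f z) ` \<F>"
      using \<open>finite \<F>\<close> by (intro Max_in) auto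
    then obtain e where "s \<mu> i e z = Max ((\<lambda>f. s \<mu> i f z) ` \<F>)" by (metis imageE)
    then show ?thesis
      using \<open>finite \<F>\<close> by (intro exI[of _ e]) auto
  qed auto
  then obtain e where e: "\<And>\<mu> i z f. f \<in> \<F> \<Longrightarrow> s \<mu> i f z \<le> s \<mu> i (e \<mu> i z) z"
    by metis
  define g where "g \<mu> i z = s \<mu> i (e \<mu> i z) z" for \<mu> i z
  have s: "0 \<le> s \<mu> i f z" "s \<mu> i f z \<le> 1" for \<mu> i f z
  proof -
    have "(\<Sum>y\<in>F. of_bool (w' \<mu> (Pointer i y) (Table f) = hidden_bit R y z)) \<le> (\<Sum>y\<in>F. 1 :: real)"
      by (intro sum_mono) auto
    then show "s \<mu> i f z \<le> 1" using cF by (simp add: s_def)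
  qed (auto simp: s_def intro!: divide_nonneg_nonneg sum_nonneg)
  have s_le_g: "s \<mu> i f (f i) \<le> g \<mu> i (f i)" if "f \<in> \<F>" for \<mu> i f
    unfolding g_def using that by (rule e)
  have g_sum: "(\<Sum>z\<in>G. g \<mu> i z) \<le> (1 / 2 + R * \<epsilon>) * real (card G)" for \<mu> i
  proof -
    have "alternating \<M> R (\<lambda>y z. w' \<mu> (Pointer i y) (Table (e \<mu> i z)))"
      using alternating_reduce[OF w', of \<mu> "Pointer i" "\<lambda>z. Table (e \<mu> i z)"] .
    from Suc.IH[OF this]
    have IH: "(\<Sum>y\<in>F. \<Sum>z\<in>G. of_bool (w' \<mu> (Pointer i y) (Table (e \<mu> i z)) = hidden_bit R y z))
            \<le> real (card F) * card G * (1 / 2 + R * \<epsilon>)" by (simp add: F_def G_def \<epsilon>_def)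
    have "(\<Sum>z\<in>G. g \<mu> i z) = (\<Sum>y\<in>F. \<Sum>z\<in>G.
        of_bool (w' \<mu> (Pointer i y) (Table (e \<mu> i z)) = hidden_bit R y z)) / real (card F)"
      by (subst sum.swap) (simp add: g_def s_def sum_divide_distrib)
    also have "\<dots> \<le> real (card F) * card G * (1 / 2 + R * \<epsilon>) / real (card F)"
      by (rule divide_right_mono[OF IH]) simp
    finally show ?thesis using cF by (simp add: mult.commute)
  qed
  have "(\<Sum>y\<in>second_inputs B (Suc R). h y) = (\<Sum>i<B. \<Sum>y\<in>F. h (Pointer i y))" for h :: "hinput \<Rightarrow> real"
    by (simp add: sum.reindex inj_on_def comp_def case_prod_unfold sum.cartesian_product F_def)
  then have "(\<Sum>x\<in>first_inputs B (Suc R). \<Sum>y\<in>second_inputs B (Suc R).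
        of_bool (w x y = hidden_bit (Suc R) x y))
      = (\<Sum>f\<in>\<F>. \<Sum>i<B. \<Sum>y\<in>F. of_bool (w (Table f) (Pointer i y) = hidden_bit R y (f i)) :: real)"
    by (simp add: sum.reindex inj_on_def \<F>_def F_def G_def del: second_inputs.simps)
  also have "\<dots> = card F * (\<Sum>f\<in>\<F>. \<Sum>i<B. s (m (Table f)) i f (f i))"
    using cF by (simp add: s_def w flip: sum_divide_distrib)
  also have "\<dots> \<le> card F * (\<Sum>f\<in>\<F>. \<Sum>i<B. g (m (Table f)) i (f i))"
    by (intro mult_left_mono sum_mono s_le_g) auto
  \<comment> \<open>For a frozen message \<open>g\<close> sees only the entry \<open>f i\<close>, so
    the coordinates are independent and the message lemma applies with
    \<open>v = 1 / 2 + R * \<epsilon>\<close>.\<close>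
  also have "\<dots> \<le> card F * (card \<F> * real B * ((1 / 2 + R * \<epsilon>) + \<epsilon>))"
    unfolding \<epsilon>_def \<F>_def
    by (intro mult_left_mono sum_message_gain_le)
      (use FG assms m s g_sum in \<open>auto simp: g_def \<epsilon>_def\<close>)
  also have "\<dots> = card (first_inputs B (Suc R)) * card (second_inputs B (Suc R)) * (1 / 2 + Suc R * \<epsilon>)"
    by (simp add: card_image inj_on_def card_cartesian_product \<F>_def F_def G_def algebra_simps)
  finally show ?case by (simp add: \<epsilon>_def)
qed

section \<open>Nested linear programs\<close>

text \<open>The image of the line \<open>Y = s X + t\<close> under \<open>(X, Y) \<mapsto> (X + c, 2 q c (X + c) - q c\<^sup>2 - Y)\<close>. The reflection
  turns upper bounds into lower bounds, which matches the exchange of the roles. The shear moves the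
  \<open>i\<close>-th block to the tangent of the parabola \<open>Y = q X\<^sup>2\<close> at \<open>c\<close>, so that above the block the lines of
  all other blocks are slack.\<close>

fun embed_line :: "nat \<Rightarrow> nat \<Rightarrow> nat \<Rightarrow> int \<times> int \<Rightarrow> int \<times> int" where
  "embed_line B D i (s, t) =
     (let c = 4 * int D * int i; q = 4 * int B * int D
      in (- s + 2 * q * c, s * c - t - q * c\<^sup>2))"

text \<open>In the base game \<open>Blank\<close> stands for Y \<ge> 0 and \<open>Bit b\<close> for
  Y \<le> X - b, so the leftmost feasible point is (b, 0). The factor \<open>4 * B\<close> is the
  growth of the coordinates per level.\<close>

fun lines :: "nat \<Rightarrow> nat \<Rightarrow> hinput \<Rightarrow> (int \<times> int) list" where
  "lines B (Suc R) (Table f) =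
     concat (map (\<lambda>i. map (embed_line B ((4 * B) ^ R) i) (lines B R (f i))) [0..<B])"
| "lines B (Suc R) (Pointer i y) = map (embed_line B ((4 * B) ^ R) i) (lines B R y)"
| "lines B R (Bit b) = [(1, - of_bool b)]"
| "lines B R x = [(0, 0)]"

definition lower_lines :: "(int \<times> int) list \<Rightarrow> (real \<times> real) set" where
  "lower_lines L = {(X, Y). \<forall>(s, t)\<in>set L. of_int s * X + of_int t \<le> Y}"

definition upper_lines :: "(int \<times> int) list \<Rightarrow> (real \<times> real) set" where
  "upper_lines L = {(X, Y). \<forall>(s, t)\<in>set L. Y \<le> of_int s * X + of_int t}"

text \<open>Only tables multiply the number of lines, and by the exchange of roles each party meets
  a table at every second level. Hence \<open>2 * r\<close> messages need only \<open>B ^ r\<close>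
  lines per party.\<close>

lemma length_lines:
  "(\<forall>x\<in>first_inputs B R. length (lines B R x) = B ^ ((R + 1) div 2)) \<and>
   (\<forall>y\<in>second_inputs B R. length (lines B R y) = B ^ (R div 2))"
proof (induction R)
  case (Suc R)
  have "length (lines B (Suc R) (Table f)) = B * B ^ (R div 2)" if "f \<in> {..<B} \<rightarrow>\<^sub>E second_inputs B R" for f
  proof -
    have "length (lines B (Suc R) (Table f)) = (\<Sum>i<B. length (lines B R (f i)))"
      by (simp add: length_concat comp_def interv_sum_list_conv_sum_set_nat atLeast0LessThan)
    also have "\<dots> = (\<Sum>i<B. B ^ (R div 2))"
      using that Suc.IH by (intro sum.cong) auto
    finally show ?thesis by simp
  qed
  then show ?case
    using Suc.IH by auto
qed auto

text \<open>The curvature \<open>q = 4 * B * D\<close> is also the new scale, and the centres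
  \<open>c\<close> stay below it. So the tangents have slope at most \<open>2 * q^2\<close> and
  intercept at most \<open>q^3\<close>, and the factors 4 leave room for the old
  coefficients.\<close>

lemma embed_line_bounded:
  assumes "\<bar>s\<bar> \<le> 4 * int D ^ 2" "\<bar>t\<bar> \<le> 4 * int D ^ 3" "i < B"
    and "embed_line B D i (s, t) = (s', t')"
  shows "\<bar>s'\<bar> \<le> 4 * int (4 * B * D) ^ 2 \<and> \<bar>t'\<bar> \<le> 4 * int (4 * B * D) ^ 3"
proof -
  define b d j where "b = int B" and "d = int D" and "j = int i"
  have b: "b \<ge> 1" "j \<ge> 0" "j \<le> b" "d \<ge> 0" using assms by (auto simp: b_def d_def j_def)
  have c: "0 \<le> 4 * d * j" "4 * d * j \<le> 4 * b * d"
    using b mult_left_mono[of j b "4 * d"] by (auto simp: mult_ac)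
  have bpow: "1 \<le> b\<^sup>2" "1 \<le> b ^ 3" "b \<le> b ^ 3"
    using b by (auto simp: one_le_power self_le_power)
  have s': "s' = - s + 2 * (4 * b * d) * (4 * d * j)"
    and t': "t' = s * (4 * d * j) - t - (4 * b * d) * (4 * d * j)\<^sup>2"
    using assms(4) by (auto simp: Let_def b_def d_def j_def)
  have "(4 * b * d) * (4 * d * j) \<le> (4 * b * d) * (4 * b * d)"
    using b c by (intro mult_left_mono) auto
  moreover have "0 \<le> (4 * b * d) * (4 * d * j)"
    using b c by simp
  moreover have "1 * d\<^sup>2 \<le> b\<^sup>2 * d\<^sup>2"
    using bpow by (intro mult_right_mono) auto
  then have "16 * d\<^sup>2 \<le> (4 * b * d) * (4 * b * d)"
    by (simp add: power2_eq_square mult_ac)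
  ultimately have "\<bar>s'\<bar> \<le> 4 * ((4 * b * d) * (4 * b * d))"
    using assms(1) unfolding s' d_def[symmetric] by linarith
  then have "\<bar>s'\<bar> \<le> 4 * (4 * b * d) ^ 2"
    by (simp only: power2_eq_square)
  moreover have "\<bar>t'\<bar> \<le> 4 * (4 * b * d) ^ 3"
  proof -
    have "\<bar>s * (4 * d * j)\<bar> \<le> (4 * d\<^sup>2) * (4 * b * d)"
      using mult_mono[of "\<bar>s\<bar>" "4 * d\<^sup>2" "4 * d * j" "4 * b * d"] assms(1) c b
      by (simp add: abs_mult d_def)
    then have "\<bar>s * (4 * d * j)\<bar> \<le> 16 * (b * d ^ 3)"
      by (simp add: power2_eq_square power3_eq_cube mult_ac)
    moreover have "(4 * b * d) * (4 * d * j)\<^sup>2 \<le> (4 * b * d) * (4 * b * d)\<^sup>2"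
      using b c by (intro mult_left_mono power_mono) auto
    then have "(4 * b * d) * (4 * d * j)\<^sup>2 \<le> 64 * (b ^ 3 * d ^ 3)"
      by (simp add: power2_eq_square power3_eq_cube mult_ac)
    moreover have "0 \<le> (4 * b * d) * (4 * d * j)\<^sup>2"
      using b by simp
    moreover have "1 * d ^ 3 \<le> b ^ 3 * d ^ 3" "b * d ^ 3 \<le> b ^ 3 * d ^ 3"
      using b mult_right_mono[OF bpow(2), of "d ^ 3"] mult_right_mono[OF bpow(3), of "d ^ 3"] by auto
    ultimately have "\<bar>t'\<bar> \<le> 256 * (b ^ 3 * d ^ 3)"
      using assms(2) unfolding t' d_def[symmetric] by linarith
    then show ?thesis
      by (simp add: power_mult_distrib)
  qed
  ultimately show ?thesis by (simp add: b_def d_def)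
qed

lemma lines_bounded:
  assumes "x \<in> first_inputs B R \<union> second_inputs B R" "(s, t) \<in> set (lines B R x)" "B > 0"
  shows "\<bar>s\<bar> \<le> 4 * int ((4 * B) ^ R) ^ 2 \<and> \<bar>t\<bar> \<le> 4 * int ((4 * B) ^ R) ^ 3"
  using assms
proof (induction R arbitrary: x s t)
  case 0
  then show ?case by (auto split: if_splits)
next
  case (Suc R)
  define D where "D = (4 * B) ^ R"
  obtain i y s0 t0 where i: "i < B" and y: "y \<in> first_inputs B R \<union> second_inputs B R"
    and st: "(s0, t0) \<in> set (lines B R y)" "embed_line B D i (s0, t0) = (s, t)"
    using Suc.prems by (fastforce simp: D_def)
  have "\<bar>s0\<bar> \<le> 4 * int D ^ 2" "\<bar>t0\<bar> \<le> 4 * int D ^ 3"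
    using Suc.IH[OF y st(1) Suc.prems(3)] by (auto simp: D_def)
  from embed_line_bounded[OF this i st(2)] show ?case
    by (simp add: D_def)
qed


section \<open>Half-planes under the embedding, and the location of the optimum\<close>

lemma embed_line_lower_iff:
  fixes X Y :: real
  assumes "embed_line B D i (s, t) = (s', t')" "c = 4 * real D * real i" "q = 4 * real B * real D"
  shows "of_int s' * X + of_int t' \<le> Y \<longleftrightarrow>
    2 * q * c * X - q * c\<^sup>2 - Y \<le> of_int s * (X - c) + of_int t"
proof -
  have st: "real_of_int s' = - of_int s + 2 * q * c" "real_of_int t' = of_int s * c - of_int t - q * c\<^sup>2"
    using assms by (auto simp: Let_def)
  show ?thesis unfolding st by (simp add: algebra_simps)
qed

lemma embed_line_upper_iff:
  fixes X Y :: real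
  assumes "embed_line B D i (s, t) = (s', t')" "c = 4 * real D * real i" "q = 4 * real B * real D"
  shows "Y \<le> of_int s' * X + of_int t' \<longleftrightarrow>
    of_int s * (X - c) + of_int t \<le> 2 * q * c * X - q * c\<^sup>2 - Y"
proof -
  have st: "real_of_int s' = - of_int s + 2 * q * c" "real_of_int t' = of_int s * c - of_int t - q * c\<^sup>2"
    using assms by (auto simp: Let_def)
  show ?thesis unfolding st by (simp add: algebra_simps)
qed

text \<open>The point on the right is the preimage of \<open>(X, Y)\<close> under the affine map of
  \<open>embed_line\<close>; the reflection turns lower into upper.\<close>

lemma lower_lines_embed_iff:
  assumes "c = 4 * real D * real i" "q = 4 * real B * real D"
  shows "(X, Y) \<in> lower_lines (map (embed_line B D i) L) \<longleftrightarrow>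
    (X - c, 2 * q * c * X - q * c\<^sup>2 - Y) \<in> upper_lines L"
proof -
  have "(\<forall>(s, t)\<in>set (map (embed_line B D i) L). of_int s * X + of_int t \<le> Y) \<longleftrightarrow>
     (\<forall>(s, t)\<in>set L. case embed_line B D i (s, t) of (s', t') \<Rightarrow> of_int s' * X + of_int t' \<le> Y)"
    by (auto simp del: embed_line.simps)
  also have "\<dots> \<longleftrightarrow> (\<forall>(s, t)\<in>set L. 2 * q * c * X - q * c\<^sup>2 - Y \<le> of_int s * (X - c) + of_int t)"
    using embed_line_lower_iff[OF _ assms] by (auto simp del: embed_line.simps split: prod.splits) 
  finally show ?thesis by (simp add: lower_lines_def upper_lines_def)
qed

lemma upper_lines_embed_iff:
  assumes "c = 4 * real D * real i" "q = 4 * real B * real D"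
  shows "(X, Y) \<in> upper_lines (map (embed_line B D i) L) \<longleftrightarrow>
    (X - c, 2 * q * c * X - q * c\<^sup>2 - Y) \<in> lower_lines L"
proof -
  have "(\<forall>(s, t)\<in>set (map (embed_line B D i) L). Y \<le> of_int s * X + of_int t) \<longleftrightarrow>
     (\<forall>(s, t)\<in>set L. case embed_line B D i (s, t) of (s', t') \<Rightarrow> Y \<le> of_int s' * X + of_int t')"
    by (auto simp del: embed_line.simps)
  also have "\<dots> \<longleftrightarrow> (\<forall>(s, t)\<in>set L. of_int s * (X - c) + of_int t \<le> 2 * q * c * X - q * c\<^sup>2 - Y)"
    using embed_line_upper_iff[OF _ assms] by (auto simp del: embed_line.simps split: prod.splits)
  finally show ?thesis by (simp add: lower_lines_def upper_lines_def)
qed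

lemma lower_lines_concat:
  "p \<in> lower_lines (concat Ls) \<longleftrightarrow> (\<forall>L\<in>set Ls. p \<in> lower_lines L)"
  by (auto simp: lower_lines_def)

text \<open>The tangents at \<open>c\<close> and \<open>c'\<close> differ at \<open>X\<close> by
  \<open>q * ((X - c')^2 - u^2)\<close>. The centres are at least \<open>4 * D\<close> apart, so
  \<open>\<bar>X - c'\<bar>\<close> is at least \<open>3 * D\<close> and the gap at least
  \<open>8 * q * D^2 = 32 * B * D^3\<close>, while \<open>v\<close>, \<open>s * (X - c')\<close> and
  \<open>t\<close> together contribute at most \<open>24 * B * D^3\<close>.\<close>

lemma other_block_slack:
  fixes u v s t :: real
  assumes "i < B" "j < B" "i \<noteq> j"
    and bounds: "\<bar>u\<bar> \<le> D" "\<bar>v\<bar> \<le> 4 * real D ^ 3" "\<bar>s\<bar> \<le> 4 * real D ^ 2" "\<bar>t\<bar> \<le> 4 * real D ^ 3"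
    and c: "c = 4 * real D * real i" "c' = 4 * real D * real j" and q: "q = 4 * real B * real D"
    and X: "X = u + c"
  shows "2 * q * c' * X - q * c'\<^sup>2 - (2 * q * c * X - q * c\<^sup>2 - v) \<le> s * (X - c') + t"
proof -
  define b d where "b = real B" and "d = real D"
  have b: "b \<ge> 1" "d \<ge> 0" using assms by (auto simp: b_def d_def)
  have ij: "\<bar>real i - real j\<bar> \<ge> 1" "\<bar>real i - real j\<bar> \<le> b - 1"
    using assms by (auto simp: b_def)
  have cc: "c - c' = 4 * d * (real i - real j)" by (simp add: c d_def algebra_simps)
  have "4 * d * 1 \<le> \<bar>c - c'\<bar>" "\<bar>c - c'\<bar> \<le> 4 * d * (b - 1)"
    unfolding cc abs_mult using ij b mult_left_mono[OF ij(1), of "4 * d"] mult_left_mono[OF ij(2), of "4 * d"]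
    by auto
  then have Xc': "3 * d \<le> \<bar>X - c'\<bar>" "\<bar>X - c'\<bar> \<le> 4 * b * d"
    using bounds(1) b unfolding X d_def[symmetric] by (auto simp: algebra_simps)
  have "9 * d\<^sup>2 \<le> (X - c')\<^sup>2"
    using power_mono[OF Xc'(1), of 2] b by (simp add: power_mult_distrib)
  moreover have "u\<^sup>2 \<le> d\<^sup>2"
    using power_mono[OF bounds(1), of 2] by (simp add: d_def)
  ultimately have "q * (8 * d\<^sup>2) \<le> q * ((X - c')\<^sup>2 - u\<^sup>2)"
    using b by (intro mult_left_mono) (auto simp: q)
  then have "32 * (b * d ^ 3) \<le> q * ((X - c')\<^sup>2 - u\<^sup>2)"
    by (simp add: q b_def d_def power2_eq_square power3_eq_cube mult_ac)
  moreover have "\<bar>s * (X - c')\<bar> \<le> (4 * d ^ 2) * (4 * b * d)"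
    unfolding abs_mult using bounds(3) Xc'(2) by (intro mult_mono) (auto simp: d_def)
  then have "\<bar>s * (X - c')\<bar> \<le> 16 * (b * d ^ 3)"
    by (simp add: power2_eq_square power3_eq_cube mult_ac)
  moreover have "1 * d ^ 3 \<le> b * d ^ 3" using b by (intro mult_right_mono) auto
  ultimately have "v - s * (X - c') - t \<le> q * ((X - c')\<^sup>2 - u\<^sup>2)"
    using bounds(2,4) unfolding d_def[symmetric] by linarith
  then show ?thesis by (simp add: X power2_eq_square algebra_simps)
qed

definition leftmost :: "(real \<times> real) set \<Rightarrow> real \<times> real \<Rightarrow> bool" where
  "leftmost S p \<longleftrightarrow> p \<in> S \<and> (\<forall>p'\<in>S. fst p \<le> fst p')"

text \<open>The witness is the image of the optimum of the selected subgame; it is feasible because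
  the other blocks are slack there. The bounds on its coordinates are what the slackness argument
  needs one level up.\<close>

lemma leftmost_point_exists:
  assumes "x \<in> first_inputs B R" "y \<in> second_inputs B R"
  shows "\<exists>X Y. leftmost (lower_lines (lines B R x) \<inter> upper_lines (lines B R y)) (of_int X, of_int Y)
    \<and> \<bar>X\<bar> \<le> int ((4 * B) ^ R) \<and> \<bar>Y\<bar> \<le> 4 * int ((4 * B) ^ R) ^ 3 \<and> (odd X \<longleftrightarrow> hidden_bit R x y)"
  using assms
proof (induction R arbitrary: x y)
  case 0
  then show ?case
    by (intro exI[of _ "of_bool (y = Bit True)"] exI[of _ 0])
      (auto simp: leftmost_def lower_lines_def upper_lines_def)
next
  case (Suc R)
  define D where "D = (4 * B) ^ R"
  obtain f where f: "f \<in> {..<B} \<rightarrow>\<^sub>E second_inputs B R" "x = Table f" using Suc.prems by auto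
  obtain i z where z: "z \<in> first_inputs B R" "i < B" "y = Pointer i z" using Suc.prems by auto
  have fi: "f i \<in> second_inputs B R" using f z by auto
  from Suc.IH[OF z(1) fi] obtain X Y where
    opt: "leftmost (lower_lines (lines B R z) \<inter> upper_lines (lines B R (f i))) (of_int X, of_int Y)"
    and XY: "\<bar>X\<bar> \<le> int D" "\<bar>Y\<bar> \<le> 4 * int D ^ 3" "odd X \<longleftrightarrow> hidden_bit R z (f i)"
    unfolding D_def by blast
  define c q where "c = 4 * int D * int i" and "q = 4 * int B * int D"
  define X' Y' where "X' = X + c" and "Y' = 2 * q * c * X' - q * c\<^sup>2 - Y"
  have c: "real_of_int c = 4 * real D * real i" and q: "real_of_int q = 4 * real B * real D"
    by (auto simp: c_def q_def)
  have B: "B > 0" "D > 0" using z by (auto simp: D_def)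
  have x_eq: "lines B (Suc R) x = concat (map (\<lambda>j. map (embed_line B D j) (lines B R (f j))) [0..<B])"
    and y_eq: "lines B (Suc R) y = map (embed_line B D i) (lines B R z)"
    by (auto simp: f z D_def)
  have preimage: "(real_of_int X' - of_int c, 2 * of_int q * of_int c * of_int X' - of_int q * (of_int c)\<^sup>2 - of_int Y')
      = (real_of_int X, real_of_int Y)"
    by (simp add: X'_def Y'_def)
  have "(of_int X', of_int Y') \<in> lower_lines (map (embed_line B D j) (lines B R (f j)))" if "j < B" for j
  proof (cases "j = i")
    case True
    then show ?thesis
      unfolding True lower_lines_embed_iff[OF c q] preimage using opt by (simp add: leftmost_def)
  next
    case False
    define c' where "c' = 4 * real D * real j"
    have "2 * q * c' * X' - q * c'\<^sup>2 - Y' \<le> s * (X' - c') + t"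
      if st: "(s, t) \<in> set (lines B R (f j))" for s t
    proof -
      have "\<bar>s\<bar> \<le> 4 * int D ^ 2 \<and> \<bar>t\<bar> \<le> 4 * int D ^ 3"
        unfolding D_def using f \<open>j < B\<close> by (intro lines_bounded[OF _ st B(1)]) auto
      then have "real_of_int \<bar>s\<bar> \<le> real_of_int (4 * int D ^ 2)" "real_of_int \<bar>t\<bar> \<le> real_of_int (4 * int D ^ 3)"
        by (simp_all only: of_int_le_iff)
      then have "\<bar>real_of_int s\<bar> \<le> 4 * real D ^ 2" "\<bar>real_of_int t\<bar> \<le> 4 * real D ^ 3"
        by simp_all
      moreover have "real_of_int \<bar>X\<bar> \<le> real_of_int (int D)" "real_of_int \<bar>Y\<bar> \<le> real_of_int (4 * int D ^ 3)"
        using XY by (simp_all only: of_int_le_iff)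
      then have "\<bar>real_of_int X\<bar> \<le> D" "\<bar>real_of_int Y\<bar> \<le> 4 * real D ^ 3"
        by simp_all
      ultimately show ?thesis
        using other_block_slack[OF z(2) \<open>j < B\<close> False[symmetric], of X D Y s t c c' q "real_of_int X'"] c c'_def q
        by (simp add: X'_def Y'_def)
    qed
    then show ?thesis
      unfolding lower_lines_embed_iff[OF c'_def q] by (auto simp: upper_lines_def)
  qed
  moreover have "(of_int X', of_int Y') \<in> upper_lines (lines B (Suc R) y)"
    unfolding y_eq upper_lines_embed_iff[OF c q] preimage using opt by (simp add: leftmost_def)
  \<comment> \<open>Block \<open>i\<close> and the lines of the pointer alone force this: the
    embedding shifts every abscissa by \<open>c\<close> and so preserves their order.\<close>
  moreover have "of_int X' \<le> P"
    if "(P, Q) \<in> lower_lines (lines B (Suc R) x)" "(P, Q) \<in> upper_lines (lines B (Suc R) y)" for P Q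
  proof -
    have "(P, Q) \<in> lower_lines (map (embed_line B D i) (lines B R (f i)))"
      using that(1) z(2) unfolding x_eq lower_lines_concat by auto
    then have "of_int X \<le> P - c"
      using that(2) opt unfolding y_eq lower_lines_embed_iff[OF c q] upper_lines_embed_iff[OF c q]
      by (force simp: leftmost_def)
    then show ?thesis by (simp add: X'_def)
  qed
  ultimately have "leftmost (lower_lines (lines B (Suc R) x) \<inter> upper_lines (lines B (Suc R) y))
      (of_int X', of_int Y')"
    by (auto simp: leftmost_def x_eq lower_lines_concat)
  \<comment> \<open>The shift \<open>c\<close> is a multiple of 4, so the parity survives.\<close>
  moreover have "odd X' \<longleftrightarrow> hidden_bit (Suc R) x y"
    using XY(3) by (simp add: X'_def c_def f z)
  moreover have "\<bar>X'\<bar> \<le> 4 * int B * int D" "\<bar>Y'\<bar> \<le> 4 * (4 * int B * int D) ^ 3"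
  proof -
    define b d where "b = int B" and "d = int D"
    have b: "b \<ge> 1" "d \<ge> 0" using B by (auto simp: b_def d_def)
    have "4 * d * int i \<le> 4 * d * (b - 1)" using b z by (intro mult_left_mono) (auto simp: b_def)
    then have c: "0 \<le> c" "c \<le> 4 * b * d - 4 * d" by (auto simp: c_def d_def algebra_simps)
    then show X': "\<bar>X'\<bar> \<le> 4 * int B * int D"
      using XY(1) b unfolding X'_def b_def[symmetric] d_def[symmetric] by auto
    have q: "q = 4 * b * d" by (simp add: q_def b_def d_def)
    have "\<bar>q * c * X'\<bar> \<le> q * q * q"
      unfolding abs_mult using b c X' by (intro mult_mono[of _ "q * q"] mult_mono[of "\<bar>q\<bar>" q]) (auto simp: q b_def d_def)
    moreover have "\<bar>q * c\<^sup>2\<bar> \<le> q * q\<^sup>2"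
      unfolding abs_mult using b c by (intro mult_mono[of "\<bar>q\<bar>" q]) (auto simp: q intro!: power_mono)
    moreover have "1 * d ^ 3 \<le> b ^ 3 * d ^ 3"
      using b by (intro mult_right_mono) auto
    then have "\<bar>Y\<bar> \<le> q ^ 3"
      using XY(2) b unfolding d_def[symmetric] by (simp add: q power_mult_distrib)
    ultimately have "\<bar>Y'\<bar> \<le> 4 * q ^ 3"
      by (simp add: Y'_def power2_eq_square power3_eq_cube)
    then show "\<bar>Y'\<bar> \<le> 4 * (4 * int B * int D) ^ 3" by (simp add: q_def)
  qed
  ultimately show ?case
    by (intro exI[of _ X'] exI[of _ Y']) (auto simp: D_def mult.assoc)
qed

section \<open>The game as a distributed linear program\<close>

definition lower_constr :: "int \<times> int \<Rightarrow> lin_constr" where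
  "lower_constr = (\<lambda>(s, t). (vector [of_int s, -1], - of_int t))"

definition upper_constr :: "int \<times> int \<Rightarrow> lin_constr" where
  "upper_constr = (\<lambda>(s, t). (vector [- of_int s, 1], of_int t))"

text \<open>All further sites are empty, so one two-party game serves every
  \<open>k \<ge> 2\<close>.\<close>

definition two_site_lp :: "real ^ 2 \<Rightarrow> lin_constr list \<Rightarrow> lin_constr list \<Rightarrow> dist_lp" where
  "two_site_lp c U V = (c, \<lambda>j. if j = 0 then U else if j = 1 then V else [])"

text \<open>The constraints \<open>(0, 0)\<close> are void and pad the program to \<open>n\<close> constraints.\<close>

definition first_site :: "nat \<Rightarrow> nat \<Rightarrow> nat \<Rightarrow> hinput \<Rightarrow> lin_constr list" where
  "first_site n B R x = map lower_constr (lines B R x)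
     @ replicate (n - B ^ ((R + 1) div 2) - B ^ (R div 2)) (0, 0)"

definition second_site :: "nat \<Rightarrow> nat \<Rightarrow> hinput \<Rightarrow> lin_constr list" where
  "second_site B R y = map upper_constr (lines B R y)"

definition hard_lp :: "nat \<Rightarrow> nat \<Rightarrow> nat \<Rightarrow> hinput \<Rightarrow> hinput \<Rightarrow> dist_lp" where
  "hard_lp n B R x y = two_site_lp (vector [1, 0]) (first_site n B R x) (second_site B R y)"

lemma all_constrs_two_site_lp:
  "k \<ge> 2 \<Longrightarrow> all_constrs k (snd (two_site_lp c U V)) = set U \<union> set V"
proof -
  assume "k \<ge> 2"
  then have "{..<k} = insert 0 (insert 1 {2..<k})" by auto
  then show ?thesis
    by (auto simp: all_constrs_def two_site_lp_def)
qed

lemma feasible_hard_lp: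
  assumes "k \<ge> 2"
  shows "feasible (all_constrs k (snd (hard_lp n B R x y))) =
    {p. (p $ 1, p $ 2) \<in> lower_lines (lines B R x) \<inter> upper_lines (lines B R y)}"
proof -
  have "(\<forall>(a, b)\<in>set (first_site n B R x). a \<bullet> p \<le> b) \<longleftrightarrow> (p $ 1, p $ 2) \<in> lower_lines (lines B R x)"
    for p :: "real ^ 2"
    by (auto simp: first_site_def lower_lines_def lower_constr_def inner_vec_def sum_2 case_prod_unfold ball_Un)
  moreover have "(\<forall>(a, b)\<in>set (second_site B R y). a \<bullet> p \<le> b) \<longleftrightarrow> (p $ 1, p $ 2) \<in> upper_lines (lines B R y)"
    for p :: "real ^ 2"
    by (auto simp: second_site_def upper_lines_def upper_constr_def inner_vec_def sum_2 case_prod_unfold)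
  ultimately show ?thesis
    unfolding hard_lp_def all_constrs_two_site_lp[OF assms] feasible_def ball_Un by auto
qed

lemma lp_optimal_hard_lp_iff:
  assumes "k \<ge> 2"
  shows "lp_optimal (vector [1, 0]) (all_constrs k (snd (hard_lp n B R x y))) p \<longleftrightarrow>
    leftmost (lower_lines (lines B R x) \<inter> upper_lines (lines B R y)) (p $ 1, p $ 2)"
    (is "_ \<longleftrightarrow> leftmost ?S _")
proof -
  have "(\<forall>q :: real ^ 2. (q $ 1, q $ 2) \<in> ?S \<longrightarrow> p $ 1 \<le> q $ 1) \<longleftrightarrow> (\<forall>p'\<in>?S. p $ 1 \<le> fst p')"
    (is "?l \<longleftrightarrow> ?r")
  proof
    assume l: ?l
    show ?r
    proof
      fix p' assume "p' \<in> ?S"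
      then show "p $ 1 \<le> fst p'"
        using l[rule_format, of "vector [fst p', snd p']"] by simp
    qed
  qed force
  then show ?thesis
    unfolding lp_optimal_def feasible_hard_lp[OF assms] leftmost_def is_arg_min_linorder
    by (simp add: inner_vec_def sum_2)
qed

text \<open>All optimal points share one abscissa, an integer, whatever their ordinates; so any
  correct output reveals the bit.\<close>

lemma lp_optimal_hard_lp_decode:
  assumes "k \<ge> 2" "x \<in> first_inputs B R" "y \<in> second_inputs B R"
    and "lp_optimal (vector [1, 0]) (all_constrs k (snd (hard_lp n B R x y))) p"
  shows "odd \<lfloor>p $ 1\<rfloor> \<longleftrightarrow> hidden_bit R x y"
proof -
  obtain X Y where "leftmost (lower_lines (lines B R x) \<inter> upper_lines (lines B R y)) (of_int X, of_int Y)"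
    and X: "odd X \<longleftrightarrow> hidden_bit R x y"
    using leftmost_point_exists[OF assms(2,3)] by blast
  with assms(4) have "p $ 1 = of_int X"
    unfolding lp_optimal_hard_lp_iff[OF assms(1)] leftmost_def by force
  with X show ?thesis by simp
qed

lemma hard_lp_in_lp_inputs:
  assumes "k \<ge> 2" "x \<in> first_inputs B R" "y \<in> second_inputs B R" "B > 0"
    and n: "B ^ ((R + 1) div 2) + B ^ (R div 2) \<le> n"
    and A: "4 * real ((4 * B) ^ R) ^ 3 \<le> A"
  shows "hard_lp n B R x y \<in> lp_inputs k n A"
proof -
  define D where "D = (4 * B) ^ R"
  define I where "I = snd (hard_lp n B R x y)"
  have "D \<ge> 1" using \<open>B > 0\<close> by (simp add: D_def Suc_le_eq)
  then have "real D \<ge> 1" by simp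
  then have D: "1 \<le> real D ^ 3" "real D ^ 2 \<le> real D ^ 3"
    by (auto intro: power_increasing)
  have A: "1 \<le> A" "4 * real D ^ 2 \<le> A" "4 * real D ^ 3 \<le> A"
    using A D unfolding D_def[symmetric] by auto
  have coeff: "int_bounded A (of_int s) \<and> int_bounded A (- of_int s) \<and> int_bounded A (of_int t) \<and> int_bounded A (- of_int t)"
    if "(s, t) \<in> set (lines B R z)" "z \<in> first_inputs B R \<union> second_inputs B R" for s t z
  proof -
    have "\<bar>s\<bar> \<le> 4 * int D ^ 2 \<and> \<bar>t\<bar> \<le> 4 * int D ^ 3"
      using lines_bounded[OF that(2,1) \<open>B > 0\<close>] by (simp add: D_def)
    then have "real_of_int \<bar>s\<bar> \<le> real_of_int (4 * int D ^ 2)" "real_of_int \<bar>t\<bar> \<le> real_of_int (4 * int D ^ 3)"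
      by (simp_all only: of_int_le_iff)
    then have "\<bar>real_of_int s\<bar> \<le> 4 * real D ^ 2" "\<bar>real_of_int t\<bar> \<le> 4 * real D ^ 3"
      by simp_all
    with A show ?thesis by (auto simp: int_bounded_def)
  qed
  have small: "int_bounded A 0" "int_bounded A 1" "int_bounded A (-1)"
    using A by (auto simp: int_bounded_def)
  have "{..<k} = insert 0 (insert 1 {2..<k})" using \<open>k \<ge> 2\<close> by auto
  then have "(\<Sum>j<k. length (I j)) = length (first_site n B R x) + length (second_site B R y)"
    by (simp add: I_def hard_lp_def two_site_lp_def)
  \<comment> \<open>By the assumption on \<open>n\<close> the truncated subtraction in the padding
    is exact.\<close>
  also have "\<dots> = n"
    using length_lines[of B R] assms by (auto simp: first_site_def second_site_def)
  finally have "(\<Sum>j<k. length (I j)) = n" .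
  moreover have "\<forall>(a, b)\<in>all_constrs k I. (\<forall>i. int_bounded A (a $ i)) \<and> int_bounded A b"
    unfolding I_def hard_lp_def all_constrs_two_site_lp[OF \<open>k \<ge> 2\<close>]
    using coeff assms(2,3) small
    by (auto simp: first_site_def second_site_def lower_constr_def upper_constr_def forall_2)
  moreover have "\<forall>i :: 2. int_bounded A (vector [1, 0] $ i)"
    unfolding forall_2 using small by simp
  moreover have "\<exists>p. lp_optimal (vector [1, 0]) (all_constrs k I) p"
  proof -
    obtain X Y where "leftmost (lower_lines (lines B R x) \<inter> upper_lines (lines B R y)) (of_int X, of_int Y)"
      using leftmost_point_exists[OF assms(2,3)] by blast
    then show ?thesis
      unfolding I_def lp_optimal_hard_lp_iff[OF \<open>k \<ge> 2\<close>]
      by (intro exI[of _ "vector [of_int X, of_int Y]"]) simp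
  qed
  moreover have "hard_lp n B R x y = (vector [1, 0], I)"
    by (simp add: I_def hard_lp_def two_site_lp_def)
  ultimately show ?thesis
    by (simp add: lp_inputs_def forall_2)
qed

section \<open>Protocols\<close>

lemma length_replies: "length (replies P k (c, I) t) = t"
  by (induction t) (auto simp: Let_def)

lemma replies_nth:
  "t < r \<Longrightarrow> replies P k (c, I) r ! t =
     map (\<lambda>j. site_msg P c j (I j) (received P c (replies P k (c, I) t) j)) [0..<k]"
  by (induction r) (auto simp: Let_def nth_append length_replies less_Suc_eq)

lemma length_reply_le_run_bits:
  assumes "t < r" "j < k"
  shows "length (site_msg P c j (I j) (received P c (replies P k (c, I) t) j)) \<le> run_bits r k P (c, I)"
proof -
  define g where "g t j = length (coord_msg P c (replies P k (c, I) t) j)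
    + length (replies P k (c, I) r ! t ! j)" for t j
  have "length (site_msg P c j (I j) (received P c (replies P k (c, I) t) j)) \<le> g t j"
    using assms by (simp add: g_def replies_nth)
  also have "\<dots> \<le> (\<Sum>j<k. g t j)"
    using assms by (intro member_le_sum) auto
  also have "\<dots> \<le> (\<Sum>t<r. \<Sum>j<k. g t j)"
    using assms by (intro member_le_sum[of t "{..<r}" "\<lambda>t. \<Sum>j<k. g t j"]) auto
  finally show ?thesis by (simp add: run_bits_def g_def)
qed

text \<open>A round is cut into two messages, the second of which ignores the first.\<close>

lemma alternating_simultaneous_rounds:
  fixes step :: "'h \<Rightarrow> 'm \<Rightarrow> 'm \<Rightarrow> 'h"
  assumes "\<And>H x. a H x \<in> \<M>" "\<And>H y. b H y \<in> \<M>"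
  shows "alternating \<M> (2 * t) (\<lambda>x y. out (((\<lambda>H. step H (a H x) (b H y)) ^^ t) H))"
proof (induction t arbitrary: H)
  case (Suc t)
  have "alternating \<M> (Suc (2 * t))
     (\<lambda>y x. out (((\<lambda>H. step H (a H x) (b H y)) ^^ t) (step H \<mu> (b H y))))" for \<mu>
    using assms(2) Suc.IH
    by (auto intro!: exI[of _ "b H"]
        exI[of _ "\<lambda>\<nu> x y. out (((\<lambda>H. step H (a H x) (b H y)) ^^ t) (step H \<mu> \<nu>))"])
  then have "alternating \<M> (Suc (Suc (2 * t)))
     (\<lambda>x y. out (((\<lambda>H. step H (a H x) (b H y)) ^^ t) (step H (a H x) (b H y))))"
    unfolding alternating.simps(2)[of _ "Suc _"]
    using assms(1) by (intro exI[of _ "a H"] exI[of _ "\<lambda>\<mu> y x. out (((\<lambda>H. step H (a H x) (b H y)) ^^ t) (step H \<mu> (b H y)))"]) auto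
  then show ?case by (simp add: funpow_Suc_right del: funpow.simps)
qed auto

text \<open>The coordinator and the empty sites act on the history alone, so both parties can
  simulate them. Truncating replies to \<open>C\<close> bits keeps every message in a finite set for
  all inputs, and changes nothing on runs within the budget.\<close>

lemma run_output_alternating:
  fixes U V :: "'x \<Rightarrow> lin_constr list"
  assumes "k \<ge> 2"
  shows "\<exists>w. alternating {l :: msg. length l \<le> C} (2 * r) w \<and>
    (\<forall>x y. run_bits r k P (two_site_lp c (U x) (V y)) \<le> C \<longrightarrow>
       w x y = out (run_output r k P (two_site_lp c (U x) (V y))))"
proof -
  define a where "a H x = take C (site_msg P c 0 (U x) (received P c H 0))" for H x
  define b where "b H y = take C (site_msg P c 1 (V y) (received P c H 1))" for H y
  define step where "step H \<mu> \<nu> =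
    H @ [\<mu> # \<nu> # map (\<lambda>j. site_msg P c j [] (received P c H j)) [2..<k]]" for H \<mu> \<nu>
  define w where "w = (\<lambda>x y. out (answer P c (((\<lambda>H. step H (a H x) (b H y)) ^^ r) [])))"
  have "w x y = out (run_output r k P (two_site_lp c (U x) (V y)))"
    if bits: "run_bits r k P (two_site_lp c (U x) (V y)) \<le> C" for x y
  proof -
    define I where "I = (\<lambda>j::nat. if j = 0 then U x else if j = 1 then V y else [])"
    have lp: "two_site_lp c (U x) (V y) = (c, I)" by (simp add: two_site_lp_def I_def)
    have "replies P k (c, I) t = ((\<lambda>H. step H (a H x) (b H y)) ^^ t) []" if "t \<le> r" for t
      using that
    proof (induction t)
      case (Suc t)
      define H where "H = replies P k (c, I) t"
      have upt: "[0..<k] = 0 # 1 # [2..<k]"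
        using assms by (simp add: upt_rec[of 0] upt_rec[of "Suc 0"] numeral_2_eq_2)
      have len: "length (site_msg P c j (I j) (received P c H j)) \<le> C" if "j < k" for j
        using length_reply_le_run_bits[of t r j k P c I] Suc.prems that bits by (simp add: lp H_def)
      have "a H x = site_msg P c 0 (I 0) (received P c H 0)"
        "b H y = site_msg P c 1 (I 1) (received P c H 1)"
        using len[of 0] len[of 1] assms by (auto simp: a_def b_def I_def)
      moreover have "map (\<lambda>j. site_msg P c j (I j) (received P c H j)) [2..<k]
          = map (\<lambda>j. site_msg P c j [] (received P c H j)) [2..<k]"
        by (auto simp: I_def)
      ultimately have "replies P k (c, I) (Suc t) = step H (a H x) (b H y)"
        by (simp add: Let_def H_def[symmetric] step_def upt del: upt_Suc)
      then show ?case using Suc by (simp add: H_def)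
    qed simp
    then show ?thesis by (simp add: w_def run_output_def lp)
  qed
  moreover have "alternating {l :: msg. length l \<le> C} (2 * r) w"
    unfolding w_def by (rule alternating_simultaneous_rounds) (auto simp: a_def b_def)
  ultimately show ?thesis by blast
qed

section \<open>From randomized to deterministic protocols\<close>

lemma (in prob_space) prob_le_average:
  assumes "finite A" "A \<noteq> {}" "p > 0"
    and p: "\<And>a. a \<in> A \<Longrightarrow> p \<le> prob {\<omega>\<in>space M. Q a \<omega>}"
    and avg: "\<And>\<omega>. \<omega> \<in> space M \<Longrightarrow> (\<Sum>a\<in>A. of_bool (Q a \<omega>)) \<le> \<sigma> * real (card A)"
  shows "p \<le> \<sigma>"
proof -
  \<comment> \<open>A non-measurable event has measure 0, which the bound \<open>p > 0\<close>
    excludes.\<close>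
  have ev: "{\<omega>\<in>space M. Q a \<omega>} \<in> events" if "a \<in> A" for a
    using p[OF that] \<open>p > 0\<close> measure_notin_sets by fastforce
  have "p * real (card A) \<le> (\<Sum>a\<in>A. prob {\<omega>\<in>space M. Q a \<omega>})"
    using sum_mono[of A "\<lambda>_. p", OF p] by (simp add: mult.commute)
  also have "\<dots> = (\<Sum>a\<in>A. expectation (indicator {\<omega>\<in>space M. Q a \<omega>}))"
    using ev by simp
  also have "\<dots> = expectation (\<lambda>\<omega>. \<Sum>a\<in>A. indicator {\<omega>\<in>space M. Q a \<omega>} \<omega>)"
    using ev by (subst Bochner_Integration.integral_sum) (auto simp: less_top[symmetric])
  also have "\<dots> \<le> expectation (\<lambda>_. \<sigma> * real (card A))"
  proof (rule integral_mono)
    show "integrable M (\<lambda>\<omega>. \<Sum>a\<in>A. indicator {\<omega>\<in>space M. Q a \<omega>} \<omega> :: real)"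
      using ev by (intro Bochner_Integration.integrable_sum) (auto simp: less_top[symmetric])
  qed (use avg in \<open>auto simp: indicator_def of_bool_def\<close>)
  finally show ?thesis
    using assms(1,2) by (simp add: prob_space card_gt_0_iff)
qed

text \<open>The easy direction of Yao's principle: success on every input implies success on average
  over uniform hard inputs, so some bound valid for each deterministic protocol must already reach
  2/3.\<close>

lemma solves_lps_success_le:
  assumes "solves_lps r k (lp_inputs k n A) M" "comm_at_most r k (lp_inputs k n A) M C" "k \<ge> 2"
    and "B > 0" "B ^ ((R + 1) div 2) + B ^ (R div 2) \<le> n" "4 * real ((4 * B) ^ R) ^ 3 \<le> A"
    and \<sigma>: "\<And>w. alternating {l :: msg. length l \<le> C} (2 * r) w \<Longrightarrow>
      (\<Sum>x\<in>first_inputs B R. \<Sum>y\<in>second_inputs B R. of_bool (w x y = hidden_bit R x y))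
        \<le> real (card (first_inputs B R)) * real (card (second_inputs B R)) * \<sigma>"
  shows "2 / 3 \<le> \<sigma>"
proof -
  interpret prob_space M using assms(1) by (simp add: solves_lps_def)
  define Q where "Q = (\<lambda>(x, y) P. lp_optimal (vector [1, 0]) (all_constrs k (snd (hard_lp n B R x y)))
    (run_output r k P (hard_lp n B R x y)))"
  define T where "T = first_inputs B R \<times> second_inputs B R"
  have valid: "hard_lp n B R x y \<in> lp_inputs k n A" if "(x, y) \<in> T" for x y
    using that assms by (intro hard_lp_in_lp_inputs) (auto simp: T_def)
  have fst_lp: "fst (hard_lp n B R x y) = vector [1, 0]" for x y
    by (simp add: hard_lp_def two_site_lp_def)
  have solves: "2 / 3 \<le> prob {P \<in> space M. lp_optimal (fst X) (all_constrs k (snd X)) (run_output r k P X)}"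
    if "X \<in> lp_inputs k n A" for X
    using assms(1) that by (auto simp: solves_lps_def)
  show ?thesis
  proof (rule prob_le_average[of T "2 / 3" Q])
    show "finite T" "T \<noteq> {}"
      using finite_inputs inputs_nonempty[OF \<open>B > 0\<close>] by (auto simp: T_def)
    fix a assume "a \<in> T"
    then show "2 / 3 \<le> prob {P \<in> space M. Q a P}"
      using solves[OF valid] by (cases a) (simp add: Q_def fst_lp)
  next
    fix P assume P: "P \<in> space M"
    obtain w where w: "alternating {l :: msg. length l \<le> C} (2 * r) w"
      and run: "\<And>x y. run_bits r k P (hard_lp n B R x y) \<le> C \<Longrightarrow>
        w x y = odd \<lfloor>run_output r k P (hard_lp n B R x y) $ 1\<rfloor>"
      using run_output_alternating[OF \<open>k \<ge> 2\<close>, of C r P "vector [1, 0]" "first_site n B R" "second_site B R"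
          "\<lambda>p. odd \<lfloor>p $ 1\<rfloor>"]
      unfolding hard_lp_def by blast
    have "w x y = hidden_bit R x y" if "(x, y) \<in> T" "Q (x, y) P" for x y
    proof -
      have "run_bits r k P (hard_lp n B R x y) \<le> C"
        using assms(2) P valid[OF that(1)] by (auto simp: comm_at_most_def)
      then show ?thesis
        using run[of x y] lp_optimal_hard_lp_decode[OF \<open>k \<ge> 2\<close>, of x B R y] that
        by (simp add: Q_def T_def)
    qed
    then have "(\<Sum>a\<in>T. of_bool (Q a P)) \<le> (\<Sum>(x, y)\<in>T. of_bool (w x y = hidden_bit R x y) :: real)"
      by (intro sum_mono) (auto split: prod.splits)
    also have "\<dots> = (\<Sum>x\<in>first_inputs B R. \<Sum>y\<in>second_inputs B R. of_bool (w x y = hidden_bit R x y))"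
      by (simp only: T_def sum.cartesian_product)
    also have "\<dots> \<le> \<sigma> * real (card T)"
      using \<sigma>[OF w] by (simp only: T_def card_cartesian_product of_nat_mult mult.commute)
    finally show "(\<Sum>a\<in>T. of_bool (Q a P)) \<le> \<sigma> * real (card T)" .
  qed simp
qed

section \<open>Counting messages and choosing parameters\<close>

lemma card_short_messages:
  "card {l :: msg. length l \<le> C} \<le> 2 ^ Suc C"
  "finite {l :: msg. length l \<le> C}"
proof -
  have eq: "{l :: msg. length l \<le> C} = {l. set l \<subseteq> UNIV \<and> length l \<le> C}" by simp
  show "finite {l :: msg. length l \<le> C}" unfolding eq by (rule finite_lists_length_le) simp
  have "card {l :: msg. length l \<le> C} = (\<Sum>i\<le>C. 2 ^ i)"
    unfolding eq by (subst card_lists_length_le) (auto simp: card_UNIV_bool)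
  also have "\<dots> \<le> 2 ^ Suc C" by (induction C) auto
  finally show "card {l :: msg. length l \<le> C} \<le> 2 ^ Suc C" .
qed

text \<open>The general bound involves \<open>C + 1\<close>; positivity of \<open>C\<close> later
  turns this into \<open>2 * C\<close>. Without bits the empty string is the only message, and the
  base game cannot be won with probability above 1/2.\<close>

lemma communication_pos:
  assumes "solves_lps r k (lp_inputs k n A) M" "comm_at_most r k (lp_inputs k n A) M C"
    and "k \<ge> 2" "n \<ge> 2" "A \<ge> 4"
  shows "C > 0"
proof (rule ccontr)
  assume "\<not> C > 0"
  then have msgs: "{l :: msg. length l \<le> C} = {[]}" by auto
  have "2 / 3 \<le> (1 / 2 :: real)"
  proof (rule solves_lps_success_le[OF assms(1-3), of 1 0])
    fix w :: "hinput \<Rightarrow> hinput \<Rightarrow> bool"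
    assume "alternating {l :: msg. length l \<le> C} (2 * r) w"
    then have "alternating {[] :: msg} 0 w"
      unfolding msgs by (rule alternating_single_message)
    then show "(\<Sum>x\<in>first_inputs 1 0. \<Sum>y\<in>second_inputs 1 0. of_bool (w x y = hidden_bit 0 x y))
      \<le> real (card (first_inputs 1 0)) * real (card (second_inputs 1 0)) * (1 / 2)"
      using alternating_success_le[of "{[] :: msg}" 1 1 0 w] by simp
  qed (use assms in auto)
  then show False by simp
qed

lemma communication_lower_bound:
  assumes "solves_lps r k (lp_inputs k n A) M" "comm_at_most r k (lp_inputs k n A) M C"
    and "k \<ge> 2" "r \<ge> 1" "B > 0" "2 * B ^ r \<le> n" "4 * real ((4 * B) ^ (2 * r)) ^ 3 \<le> A"
  shows "real B \<le> 72 * (real r)\<^sup>2 * (real C + 1)"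
proof -
  define \<M> where "\<M> = {l :: msg. length l \<le> C}"
  define K where "K = real (card \<M>)"
  \<comment> \<open>With this choice \<open>2 * r * \<theta> / 8 = 1 / 12\<close>, half of the gap
    between 1/2 and 2/3. The other half must come from \<open>6 * r^2 * ln K / B\<close>, whence the
    factor 72.\<close>
  define \<theta> where "\<theta> = 1 / (3 * real r)"
  have "finite \<M>" "[] \<in> \<M>" using card_short_messages(2) by (auto simp: \<M>_def)
  then have "K > 0" by (auto simp: K_def card_gt_0_iff)
  have "K \<le> 2 ^ Suc C"
    using card_short_messages(1)[of C] unfolding K_def \<M>_def by (metis of_nat_le_iff of_nat_numeral of_nat_power)
  then have "ln K \<le> ln (2 ^ Suc C)"
    using \<open>K > 0\<close> by (subst ln_le_cancel_iff) auto
  also have "\<dots> = (real C + 1) * ln 2"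
    by (simp add: ln_realpow del: power_Suc)
  also have "\<dots> \<le> (real C + 1) * 1"
    using ln_le_minus_one[of "2 :: real"] by (intro mult_left_mono) auto
  finally have K: "ln K \<le> real C + 1" by simp
  have "2 / 3 \<le> 1 / 2 + real (2 * r) * (ln K / (\<theta> * B) + \<theta> / 8)"
  proof (rule solves_lps_success_le[OF assms(1-3), of B "2 * r"])
    fix w :: "hinput \<Rightarrow> hinput \<Rightarrow> bool"
    assume "alternating {l :: msg. length l \<le> C} (2 * r) w"
    then show "(\<Sum>x\<in>first_inputs B (2 * r). \<Sum>y\<in>second_inputs B (2 * r). of_bool (w x y = hidden_bit (2 * r) x y))
      \<le> real (card (first_inputs B (2 * r))) * real (card (second_inputs B (2 * r)))
          * (1 / 2 + real (2 * r) * (ln K / (\<theta> * B) + \<theta> / 8))"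
      using alternating_success_le[of \<M> B \<theta> "2 * r" w] \<open>finite \<M>\<close> assms by (simp add: K_def \<M>_def \<theta>_def)
  qed (use assms in auto)
  also have "\<dots> = 7 / 12 + 6 * (real r)\<^sup>2 * ln K / B"
    using assms by (simp add: \<theta>_def field_simps power2_eq_square)
  finally have "real B \<le> 72 * (real r)\<^sup>2 * ln K"
    using assms by (simp add: field_simps)
  also have "\<dots> \<le> 72 * (real r)\<^sup>2 * (real C + 1)"
    using K by (intro mult_left_mono) auto
  finally show ?thesis .
qed

theorem theorem5p23:
  shows "\<exists>(\<gamma>::real) (d::nat) (n\<^sub>0::nat). \<gamma> > 0 \<and>
    (\<forall>(r::nat) (k::nat) (n::nat) (M :: det_protocol measure) (C::nat).
       r \<ge> 1 \<longrightarrow> k \<ge> 2 \<longrightarrow> n \<ge> n\<^sub>0 \<longrightarrow>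
       solves_lps r k (lp_inputs k n (real n ^ d)) M \<longrightarrow>
       comm_at_most r k (lp_inputs k n (real n ^ d)) M C \<longrightarrow>
       real C \<ge> \<gamma> * (1 / (real r)\<^sup>2 * real n powr (1 / (2 * real r))))"
proof (rule exI[of _ "1 / 288"], rule exI[of _ 10], rule exI[of _ 4], intro conjI allI impI)
  fix r k n :: nat and M :: "det_protocol measure" and C :: nat
  assume r: "r \<ge> 1" and k: "k \<ge> 2" and n: "n \<ge> 4"
    and M: "solves_lps r k (lp_inputs k n (real n ^ 10)) M"
    and C: "comm_at_most r k (lp_inputs k n (real n ^ 10)) M C"
  define z where "z = real n powr (1 / (2 * real r))"
  have r2: "1 \<le> (real r)\<^sup>2" using r by simp
  have "4 \<le> real n" using n by simp
  also have "\<dots> \<le> real n ^ 10" using n by (intro self_le_power) auto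
  finally have "C > 0" using communication_pos[OF M C k] n by auto
  then have C1: "1 \<le> real C" by simp
  \<comment> \<open>The constant is 72 * 2 * 2, from \<open>C + 1 \<le> 2 * C\<close> and
    \<open>z < B + 1 \<le> 2 * B\<close>. For \<open>z < 2\<close> positivity of \<open>C\<close>
    suffices.\<close>
  have "z \<le> 288 * (real r)\<^sup>2 * real C"
  proof (cases "z < 2")
    case True
    have "1 * 1 \<le> (real r)\<^sup>2 * real C" using r2 C1 by (intro mult_mono) auto
    with True show ?thesis by simp
  next
    case False
    define B where "B = nat \<lfloor>z\<rfloor>"
    have B: "real B \<le> z" "z < real B + 1" "B \<ge> 2" using False by (auto simp: B_def) linarith+
    have "real B ^ (2 * r) \<le> z ^ (2 * r)" using B by (intro power_mono) auto
    also have "\<dots> = z powr real (2 * r)"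
      using n by (intro powr_realpow[symmetric]) (auto simp: z_def)
    also have "\<dots> = real n"
      using n r by (simp add: z_def powr_powr)
    finally have Bn: "B ^ (2 * r) \<le> n"
      by (metis of_nat_le_iff of_nat_power)
    have "B ^ 1 \<le> B ^ r" using B r by (intro power_increasing) auto
    then have "2 * B ^ r \<le> B ^ r * B ^ r" using B by (intro mult_right_mono) auto
    also have "\<dots> \<le> n" using Bn by (simp add: mult_2 power_add)
    finally have size: "2 * B ^ r \<le> n" .
    \<comment> \<open>This is where the exponent 10 arises: the scale
      \<open>(4 * B) ^ (2 * r)\<close> is at most \<open>n ^ 3\<close>, its cube at most
      \<open>n ^ 9\<close>, and the factor 4 at most \<open>n\<close>.\<close>
    have "4 * B \<le> B ^ 3"
      using mult_mono[of 2 B 2 B] B by (simp add: power3_eq_cube)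
    then have "(4 * B) ^ (2 * r) \<le> (B ^ 3) ^ (2 * r)" by (intro power_mono) auto
    also have "\<dots> = (B ^ (2 * r)) ^ 3" by (simp add: mult.commute flip: power_mult)
    also have "\<dots> \<le> n ^ 3" using Bn by (intro power_mono) auto
    finally have "((4 * B) ^ (2 * r)) ^ 3 \<le> (n ^ 3) ^ 3" by (intro power_mono) auto
    then have "4 * ((4 * B) ^ (2 * r)) ^ 3 \<le> n * (n ^ 3) ^ 3" using n by (intro mult_mono) auto
    also have "\<dots> = n ^ 10" by (simp flip: power_mult power_Suc)
    finally have "real (4 * ((4 * B) ^ (2 * r)) ^ 3) \<le> real (n ^ 10)" by (simp only: of_nat_le_iff)
    then have "4 * real ((4 * B) ^ (2 * r)) ^ 3 \<le> real n ^ 10" by simp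
    from communication_lower_bound[OF M C k r _ size this]
    have "real B \<le> 72 * (real r)\<^sup>2 * (real C + 1)" using B by simp
    also have "\<dots> \<le> 72 * (real r)\<^sup>2 * (2 * real C)"
      using C1 by (intro mult_left_mono) auto
    finally show ?thesis using B by linarith
  qed
  then show "1 / 288 * (1 / (real r)\<^sup>2 * real n powr (1 / (2 * real r))) \<le> real C"
    using r unfolding z_def[symmetric] by (simp add: field_simps)
qed simp

end
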